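(* Let $m,n\ge1$ be integers with $\gcd(m,n)=1$, let $(\alpha,\beta)\in\mathcal N_q(m)\times\mathcal N_q(n)$, and let $k,\ell\ge 0$ be integers. Then $\alpha^{q^k}\beta+\alpha\beta^{q^\ell}\in\mathbb F_{q^{mn}}$ is normal over $\mathbb F_q$ if and only if $q$ is odd and one of the following properties holds: (i) $m,n$ are odd; (ii) $m$ is even with $\nu_2(m)\le\nu_2(k)$; (iii) $n$ is even with $\nu_2(n)\le\nu_2(\ell)$.
   Context: Let $q$ be a prime power; all finite fields lie in a fixed algebraic closure of $\mathbb F_q$. An element $\alpha\in\mathbb F_{q^m}$ is normal over $\mathbb F_q$ if $\alpha,\alpha^q,\dots,\alpha^{q^{m-1}}$ are linearly independent over $\mathbb F_q$; $\mathcal N_q(m)$ is the set of elements of $\mathbb F_{q^m}$ normal over $\mathbb F_q$. Normality of the element $\alpha^{q^k}\beta+\alpha\beta^{q^\ell}$ is meant in $\mathbb F_{q^{mn}}$ over $\mathbb F_q$, i.e. its $q^i$-th powers, $0\le i\le mn-1$, are linearly independent over $\mathbb F_q$. For a nonzero integer $a$, $\nu_2(a)$ is the exponent of $2$ in $a$; $\nu_2(0)=\infty$. *)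

theory Defs
  imports "HOL-Algebra.Algebraic_Closure_Type" "HOL-Library.Extended_Nat" "HOL-Library.Cardinality"
begin

text \<open>
  Throughout, the type \<open>'a :: finite_field\<close> is the field with \<open>q = CARD('a)\<close> elements, and
  \<open>'a alg_closure\<close> is the fixed algebraic closure containing all its finite extensions.
\<close>

text \<open>
  The subfield with \<open>q ^ m\<close> elements (for \<open>m > 0\<close>): the roots of \<open>X ^ (q ^ m) - X\<close>. Its
  cardinality is confirmed below; for \<open>m = 0\<close> the set is the whole closure and has no meaning.
\<close>
definition Fext :: "nat \<Rightarrow> 'a :: finite_field alg_closure set" where
  "Fext m = {x. x ^ (CARD('a) ^ m) = x}"

text \<open>
  Linear independence over \<open>'a\<close> of the indexed family \<open>v 0, \<dots>, v (N - 1)\<close>; as a family, so a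
  repeated member makes it dependent.
\<close>
definition lin_indep_family :: "nat \<Rightarrow> (nat \<Rightarrow> 'a :: finite_field alg_closure) \<Rightarrow> bool" where
  "lin_indep_family N v \<longleftrightarrow>
     (\<forall>c :: nat \<Rightarrow> 'a. (\<Sum>i<N. to_ac (c i) * v i) = 0 \<longrightarrow> (\<forall>i<N. c i = 0))"

definition normal_elements :: "nat \<Rightarrow> 'a :: finite_field alg_closure set" where
  "normal_elements m = {x \<in> Fext m. lin_indep_family m (\<lambda>i. x ^ (CARD('a) ^ i))}"

definition nu2 :: "int \<Rightarrow> enat" where
  "nu2 a = (if a = 0 then \<infinity> else enat (multiplicity 2 a))"

lemma card_Fext:
  assumes "m > 0"
  shows "card (Fext m :: 'a :: finite_field alg_closure set) = CARD('a) ^ m"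
proof -
  let ?q = "CARD('a)"
  define p :: "'a alg_closure poly" where "p = Polynomial.monom 1 (?q ^ m) - Polynomial.monom 1 1"
  have "card {0, 1 :: 'a} \<le> ?q" by (intro card_mono) auto
  hence q2: "?q \<ge> 2" by simp
  hence N: "?q ^ m > 1" using assms by (intro one_less_power) auto
  have deg: "degree p = ?q ^ m"
    unfolding p_def diff_conv_add_uminus using N
    by (subst degree_add_eq_left) (auto simp: Polynomial.degree_monom_eq)
  hence p0: "p \<noteq> 0" using N by auto
  have "of_nat ?q = (0 :: 'a alg_closure)"
  proof -
    have "(\<Sum>x\<in>UNIV. x + 1) = (\<Sum>x\<in>UNIV. x :: 'a)"
      by (rule sum.reindex_bij_witness[of _ "\<lambda>x. x - 1" "\<lambda>x. x + 1"]) auto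
    hence "of_nat ?q = (0 :: 'a)" by (simp add: sum.distrib)
    hence "to_ac (of_nat ?q :: 'a) = 0" by simp
    thus ?thesis by (simp del: of_nat_eq_0_iff)
  qed
  hence "of_nat (?q ^ m) = (0 :: 'a alg_closure)" using assms by simp
  hence pd: "pderiv p = -1"
    using assms by (simp add: p_def pderiv_diff Polynomial.pderiv_monom one_pCons Polynomial.monom_0 zero_power)
  have roots: "{x. poly p x = 0} = Fext m"
    by (auto simp: p_def Fext_def Polynomial.poly_monom)
  obtain A where A: "size A = degree p" "p = smult (lead_coeff p) (\<Prod>x\<in>#A. [:-x, 1:])"
    using alg_closed_imp_factorization[OF p0] by metis
  have count: "count A x = 1" if "x \<in># A" for x
  proof (rule ccontr)
    assume "count A x \<noteq> 1"
    with that have "count A x \<ge> 2"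
      by (metis Suc_1 Suc_leI count_greater_zero_iff le_neq_implies_less One_nat_def)
    hence "{#x, x#} \<subseteq># A" by (simp add: subseteq_mset_def)
    then obtain C where C: "A = {#x, x#} + C" by (metis subset_mset.le_iff_add)
    define r where "r = smult (lead_coeff p) (\<Prod>y\<in>#C. [:-y, 1:])"
    have "p = [:-x, 1:] * ([:-x, 1:] * r)"
      by (subst A(2), simp only: C r_def) simp
    hence "poly (pderiv p) x = 0" by (simp only: pderiv_mult) simp
    with pd show False by simp
  qed
  have "{x. poly p x = 0} = set_mset A"
    using p0 by (subst A(2)) (auto simp: poly_prod_mset prod_mset_zero_iff)
  moreover have "size A = card (set_mset A)"
    using count by (simp add: size_multiset_overloaded_eq)
  ultimately show ?thesis using A(1) deg roots by simp
qed

end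

(*
  Write phi for the q-power Frobenius. Since m and n are coprime, alpha * beta is normal over the
  base field in the field with q^(m*n) elements, and by the Chinese remainder theorem the given
  element is phi^b (y) + phi^(b+d) (y) with y = alpha * beta, d = k mod m and d = -l mod n. It fails
  to be normal iff some nonzero sequence c in the base field with period m * n satisfies c (i + d) = - c i. In odd
  characteristic this happens iff the 2-adic valuation of d is less than that of m * n; in
  characteristic 2 constant sequences always qualify.
*)
theory Submission
  imports Defs "HOL-Algebra.Sylow" "HOL-Number_Theory.Cong"
begin

section \<open>Order and characteristic of a finite field\<close>

text \<open>Sylow gives the additive group a subgroup \<open>H\<close> of order \<open>r\<close>.
  Translation by a nonzero \<open>x\<close> in \<open>H\<close> permutes \<open>H\<close>, so
  comparing sums over \<open>H\<close> yields \<open>of_nat r * x = 0\<close>.\<close>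

lemma prime_dvd_CARD_finite_field:
  assumes "prime r" and "r dvd CARD('a :: finite_field)"
  shows "r = CHAR('a)"
proof -
  define G :: "'a monoid" where "G = \<lparr>carrier = UNIV, monoid.mult = (+), one = 0\<rparr>"
  have "group G"
    by (rule groupI) (auto simp: G_def add.assoc intro: exI[of _ "- _"] left_minus)
  obtain t where t: "CARD('a) = r * t" using assms(2) by (elim dvdE)
  hence "Coset.order G = r ^ 1 * t" and "finite (carrier G)" by (simp_all add: G_def Coset.order_def)
  then obtain H where H: "subgroup H G" "card H = r"
    using sylow_thm[OF assms(1) \<open>group G\<close>, of 1 t] by auto
  have "\<not> H \<subseteq> {0}"
  proof
    assume "H \<subseteq> {0}"
    hence "card H \<le> 1" using card_mono[of "{0::'a}" H] by simp
    with H(2) prime_gt_1_nat[OF assms(1)] show False by simp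
  qed
  then obtain x where x: "x \<in> H" "x \<noteq> 0" by auto
  have add: "a + b \<in> H" if "a \<in> H" "b \<in> H" for a b
    using subgroup.m_closed[OF H(1) that] by (simp add: G_def)
  have "(\<lambda>y. y + x) ` H = H"
  proof (rule card_subset_eq)
    show "card ((\<lambda>y. y + x) ` H) = card H" by (intro card_image inj_onI) simp
  qed (use add x(1) in auto)
  hence "(\<Sum>y\<in>H. y) = (\<Sum>y\<in>(\<lambda>y. y + x) ` H. y)" by simp
  also have "\<dots> = (\<Sum>y\<in>H. y + x)" by (subst sum.reindex) (auto simp: inj_on_def)
  finally have "of_nat r * x = 0" by (simp add: sum.distrib H(2))
  with x(2) have "CHAR('a) dvd r" by (simp add: of_nat_eq_0_iff_char_dvd)
  thus ?thesis using assms(1) primes_dvd_imp_eq[of "CHAR('a)" r] by simp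
qed

text \<open>Once the full power of the characteristic is split off, the cofactor has no prime
  divisor left. The power form feeds the freshman's dream in \<open>frob_add\<close>.\<close>

lemma CARD_finite_field_eq_CHAR_power:
  obtains e where "CARD('a :: finite_field) = CHAR('a) ^ e" and "e > 0"
proof -
  have "CARD('a) \<noteq> 0" by simp
  moreover have "\<not> is_unit (CHAR('a))"
    using prime_gt_1_nat[OF CHAR_prime[where ?'a = 'a]] by simp
  ultimately obtain t where t: "CARD('a) = CHAR('a) ^ multiplicity (CHAR('a)) (CARD('a)) * t"
      "\<not> CHAR('a) dvd t"
    by (metis multiplicity_decompose')
  have "t = 1"
    using prime_dvd_CARD_finite_field[where ?'a = 'a] t prime_factor_nat[of t] dvd_mult by metis
  moreover have "CARD('a) \<noteq> 1"
    using card_mono[of UNIV "{0, 1 :: 'a}"] by simp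
  ultimately show thesis using t(1) that by (metis gr0I mult.right_neutral power_0)
qed

text \<open>Links the parity of q in the theorem to the condition \<open>1 + 1 = 0\<close> that
  governs antiperiodic sequences.\<close>

lemma even_CARD_finite_field_iff: "even (CARD('a :: finite_field)) \<longleftrightarrow> (1 :: 'a) + 1 = 0"
proof
  assume "even (CARD('a))"
  hence "2 = CHAR('a)" by (intro prime_dvd_CARD_finite_field) auto
  thus "(1 :: 'a) + 1 = 0" by (metis of_nat_CHAR of_nat_1 of_nat_add one_add_one)
next
  assume "(1 :: 'a) + 1 = 0"
  hence "of_nat 2 = (0 :: 'a)" by simp
  hence "CHAR('a) dvd 2" by (simp only: of_nat_eq_0_iff_char_dvd)
  hence "CHAR('a) = 2" using primes_dvd_imp_eq[of "CHAR('a)" 2] by simp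
  thus "even (CARD('a))"
    using CARD_finite_field_eq_CHAR_power[where ?'a = 'a] by (metis dvd_power)
qed

section \<open>Powers of Frobenius and their fixed fields\<close>

definition frob :: "nat \<Rightarrow> 'a :: finite_field alg_closure \<Rightarrow> 'a alg_closure" where
  "frob i x = x ^ (CARD('a) ^ i)"

lemma frob_add [simp]: "frob i (x + y) = frob i x + frob i y"
  for x y :: "'a :: finite_field alg_closure"
proof -
  obtain e where "CARD('a) = CHAR('a) ^ e" by (rule CARD_finite_field_eq_CHAR_power)
  thus ?thesis unfolding frob_def
    by (intro freshmans_dream'[where n = "e * i"]) (simp_all add: power_mult)
qed

lemma frob_0 [simp]: "frob i 0 = 0"
  and frob_1 [simp]: "frob i 1 = 1"
  and frob_mult [simp]: "frob i (x * y) = frob i x * frob i y"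
  and frob_divide [simp]: "frob i (x / y) = frob i x / frob i y"
  and frob_zero_left [simp]: "frob 0 x = x"
  by (simp_all add: frob_def power_mult_distrib power_divide)

lemma frob_minus [simp]: "frob i (- x) = - frob i x"
  using frob_add[of i x "- x"] by (simp add: eq_neg_iff_add_eq_0 add.commute)

lemma frob_diff [simp]: "frob i (x - y) = frob i x - frob i y"
  using frob_add[of i x "- y"] by simp

lemma frob_sum: "frob i (sum f A) = (\<Sum>x\<in>A. frob i (f x))"
  by (induction A rule: infinite_finite_induct) auto

lemma frob_frob: "frob i (frob j x) = frob (i + j) x"
  by (simp add: frob_def power_add power_mult [symmetric] ac_simps)

lemma frob_to_ac [simp]: "frob i (to_ac c) = to_ac c"
  by (simp add: frob_def finite_field_power_card_power_eq_same flip: to_ac_power)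

lemma Fext_iff: "x \<in> Fext m \<longleftrightarrow> frob m x = x"
  by (simp add: Fext_def frob_def)

lemma normal_elements_iff:
  "x \<in> normal_elements m \<longleftrightarrow> x \<in> Fext m \<and> lin_indep_family m (\<lambda>i. frob i x)"
  by (simp add: normal_elements_def frob_def)

lemma frob_Fext: "x \<in> Fext m \<Longrightarrow> frob i x \<in> Fext m"
  by (metis Fext_iff add.commute frob_frob)

lemma frob_Fext_mult: "x \<in> Fext m \<Longrightarrow> frob (m * j) x = x"
  by (induction j) (auto simp: Fext_iff simp flip: frob_frob)

lemma frob_Fext_mod: "x \<in> Fext m \<Longrightarrow> frob (i mod m) x = frob i x"
  by (metis frob_frob frob_Fext_mult mod_mult_div_eq)

text \<open>This lets Frobenius exponents be chosen by the Chinese remainder theorem, one residue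
  for each factor of alpha * beta.\<close>

lemma frob_Fext_cong: "x \<in> Fext m \<Longrightarrow> [i = j] (mod m) \<Longrightarrow> frob i x = frob j x"
  by (metis cong_def frob_Fext_mod)

lemma Fext_dvd_mono: "x \<in> Fext m \<Longrightarrow> m dvd n \<Longrightarrow> x \<in> Fext n"
  by (auto simp: Fext_iff[of x n] frob_Fext_mult)

text \<open>The base field embeds in the roots of X^q - X, and both sets have q elements.\<close>

lemma Fext_1: "Fext 1 = range (to_ac :: 'a :: finite_field \<Rightarrow> _)"
proof (rule card_subset_eq[symmetric])
  have "card (Fext 1 :: 'a alg_closure set) = CARD('a)" by (simp add: card_Fext)
  \<comment> \<open>An infinite set would have \<open>card\<close> 0.\<close>
  thus "finite (Fext 1 :: 'a alg_closure set)" by (metis card.infinite zero_less_card_finite less_numeral_extra(3))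
  show "card (range (to_ac :: 'a \<Rightarrow> _)) = card (Fext 1 :: 'a alg_closure set)"
    by (simp add: card_Fext card_image inj_to_ac)
qed (auto simp: Fext_iff)

section \<open>Linear disjointness and products of normal elements\<close>

text \<open>By Bezout, phi^(m*s) = phi * phi^(n*t). Both phi^(m*s) and phi^(n*t) fix
  \<open>x\<close>, hence so does phi.\<close>

lemma Fext_coprime_Int:
  assumes "coprime m n" and "m > 0" and "x \<in> Fext m" and "x \<in> Fext n"
  shows "x \<in> range to_ac"
proof -
  obtain s t where st: "m * s = n * t + 1"
    using bezout_nat[of m n] assms(1,2) by auto
  have "frob 1 x = frob 1 (frob (n * t) x)" using assms(4) by (simp add: frob_Fext_mult)
  also have "\<dots> = frob (m * s) x" by (simp add: frob_frob st)
  finally show ?thesis using assms(3) by (simp add: frob_Fext_mult Fext_iff flip: Fext_1)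
qed

text \<open>
  The usual minimal-relation argument: after normalizing one coefficient to \<open>1\<close>, applying the
  \<open>n\<close>-th power of Frobenius and subtracting gives a shorter relation, so that all coefficients
  lie in both \<open>Fext m\<close> and \<open>Fext n\<close>.
\<close>
lemma Fext_linearly_disjoint:
  assumes "coprime m n" and "m > 0"
    and v: "\<And>j. j < n \<Longrightarrow> v j \<in> Fext n" and indep: "lin_indep_family n v"
    and "finite J" and "J \<subseteq> {..<n}"
    and "\<And>j. j \<in> J \<Longrightarrow> e j \<in> Fext m" and "(\<Sum>j\<in>J. e j * v j) = 0" and "j \<in> J"
  shows "e j = 0"
  using assms(5-9)
proof (induction J arbitrary: e j rule: finite_induct)
  case empty
  thus ?case by simp
next
  case (insert h J)
  have "e h = 0"
  proof (rule ccontr)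
    assume nz: "e h \<noteq> 0"
    define g where "g j = e j / e h" for j
    have g: "g j \<in> Fext m" if "j \<in> insert h J" for j
      using insert.prems(2)[OF that] insert.prems(2)[of h] by (simp add: g_def Fext_iff)
    have "(\<Sum>j\<in>insert h J. g j * v j) = (\<Sum>j\<in>insert h J. e j * v j) / e h"
      by (simp only: g_def sum_divide_distrib times_divide_eq_left)
    hence rel: "(\<Sum>j\<in>insert h J. g j * v j) = 0" by (simp only: insert.prems(3)) simp
    have "frob n (\<Sum>j\<in>insert h J. g j * v j) = (\<Sum>j\<in>insert h J. frob n (g j) * v j)"
      unfolding frob_sum using insert.prems(1) v by (intro sum.cong) (auto simp: Fext_iff)
    hence "(\<Sum>j\<in>insert h J. (frob n (g j) - g j) * v j) = 0"
      using rel by (simp only: left_diff_distrib sum_subtractf) simp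
    \<comment> \<open>The term at \<open>h\<close> drops out of the difference because phi^n fixes
      1.\<close>
    moreover have gh: "g h = 1" using nz by (simp add: g_def)
    ultimately have rel': "(\<Sum>j\<in>J. (frob n (g j) - g j) * v j) = 0"
      using insert.hyps by simp
    have "frob n (g j) - g j \<in> Fext m" if "j \<in> J" for j
      using g[of j] frob_Fext[OF g[of j]] that by (simp add: Fext_iff)
    from insert.IH[OF _ this rel'] insert.prems(1) have "frob n (g j) = g j" if "j \<in> J" for j
      using that by simp
    hence "g j \<in> Fext n" if "j \<in> insert h J" for j
      using that gh by (auto simp: Fext_iff)
    hence "\<forall>j\<in>insert h J. \<exists>c. g j = to_ac c"
      using Fext_coprime_Int[OF assms(1,2) g] by blast
    then obtain c where c: "g j = to_ac (c j)" if "j \<in> insert h J" for j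
      by metis
    \<comment> \<open>Extension by zero to all indices below \<open>n\<close>, the form in which
      \<open>indep\<close> applies; it forces \<open>c' h = 0\<close> against
      \<open>g h = 1\<close>.\<close>
    define c' where "c' j = (if j \<in> insert h J then c j else 0)" for j
    have "(\<Sum>j<n. to_ac (c' j) * v j) = (\<Sum>j\<in>insert h J. g j * v j)"
      by (rule sum.mono_neutral_cong_right) (use insert.prems(1) c in \<open>auto simp: c'_def\<close>)
    hence "c' h = 0"
      using rel indep[unfolded lin_indep_family_def, rule_format, of c' h] insert.prems(1) by simp
    with c[of h] gh show False by (simp add: c'_def)
  qed
  show ?case
  proof (cases "j = h")
    case False
    show ?thesis
      by (rule insert.IH) (use insert.prems insert.hyps \<open>e h = 0\<close> False in simp_all)
  qed (use \<open>e h = 0\<close> in simp)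
qed

text \<open>Injectivity is the uniqueness half of the Chinese remainder theorem; surjectivity
  follows by counting.\<close>

lemma bij_betw_mod_mod:
  fixes m n :: nat
  assumes "coprime m n" and "m > 0" and "n > 0"
  shows "bij_betw (\<lambda>t. (t mod m, t mod n)) {..<m * n} ({..<m} \<times> {..<n})"
  unfolding bij_betw_def
proof
  show "inj_on (\<lambda>t. (t mod m, t mod n)) {..<m * n}"
    by (rule inj_onI) (metis assms(1) coprime_cong_mult_nat cong_def cong_less_modulus_unique_nat
        lessThan_iff prod.inject)
  thus "(\<lambda>t. (t mod m, t mod n)) ` {..<m * n} = {..<m} \<times> {..<n}"
    using assms by (intro card_subset_eq) (auto simp: card_image)
qed

text \<open>Indexing by residues turns the conjugates of alpha * beta into all products of a
  conjugate of alpha with one of beta. Linear disjointness removes the conjugates of beta, then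
  normality of alpha removes the rest.\<close>

lemma normal_elements_mult:
  assumes "coprime m n" and "m > 0" and "n > 0"
    and "\<alpha> \<in> normal_elements m" and "\<beta> \<in> normal_elements n"
  shows "\<alpha> * \<beta> \<in> normal_elements (m * n)"
proof -
  have A: "\<alpha> \<in> Fext m" "lin_indep_family m (\<lambda>i. frob i \<alpha>)"
    and B: "\<beta> \<in> Fext n" "lin_indep_family n (\<lambda>i. frob i \<beta>)"
    using assms(4,5) by (simp_all add: normal_elements_iff)
  have "\<alpha> * \<beta> \<in> Fext (m * n)"
    using A(1) B(1) Fext_dvd_mono[of \<alpha> m "m * n"] Fext_dvd_mono[of \<beta> n "m * n"]
    by (simp add: Fext_iff)
  moreover have "c t = 0" if c: "(\<Sum>t<m * n. to_ac (c t) * frob t (\<alpha> * \<beta>)) = 0" and t: "t < m * n"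
    for c t
  proof -
    let ?f = "\<lambda>t. (t mod m, t mod n)"
    \<comment> \<open>\<open>g\<close> recovers the exponent from its two residues, so
      \<open>c\<close> becomes a matrix of coefficients.\<close>
    define g where "g = the_inv_into {..<m * n} ?f"
    note bij = bij_betw_mod_mod[OF assms(1-3)]
    have gf: "g (?f t) = t" if "t < m * n" for t
      unfolding g_def using that bij by (intro the_inv_into_f_f) (auto simp: bij_betw_def)
    have "(\<Sum>t<m * n. to_ac (c t) * frob t (\<alpha> * \<beta>)) =
      (\<Sum>t<m * n. case ?f t of (i, j) \<Rightarrow> to_ac (c (g (i, j))) * frob i \<alpha> * frob j \<beta>)"
      by (intro sum.cong refl) (use A(1) B(1) in \<open>simp add: gf frob_Fext_mod\<close>)
    also have "\<dots> = (\<Sum>(i, j)\<in>{..<m} \<times> {..<n}. to_ac (c (g (i, j))) * frob i \<alpha> * frob j \<beta>)"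
      by (rule sum.reindex_bij_betw[OF bij])
    also have "\<dots> = (\<Sum>j<n. (\<Sum>i<m. to_ac (c (g (i, j))) * frob i \<alpha>) * frob j \<beta>)"
      by (simp add: sum_distrib_right sum.swap[of _ "{..<n}"] flip: sum.cartesian_product)
    finally have rel: "(\<Sum>j<n. (\<Sum>i<m. to_ac (c (g (i, j))) * frob i \<alpha>) * frob j \<beta>) = 0"
      using c by simp
    \<comment> \<open>The inner sums are fixed by phi^m, so they may serve as coefficients in the
      disjointness lemma.\<close>
    have "(\<Sum>i<m. to_ac (c (g (i, j))) * frob i \<alpha>) \<in> Fext m" for j
      using frob_Fext[OF A(1), unfolded Fext_iff] by (simp add: Fext_iff frob_sum)
    hence "(\<Sum>i<m. to_ac (c (g (i, j))) * frob i \<alpha>) = 0" if "j < n" for j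
      using Fext_linearly_disjoint[OF assms(1,2) frob_Fext[OF B(1)] B(2) _ subset_refl _ rel] that
      by simp
    hence "c (g (i, j)) = 0" if "i < m" "j < n" for i j
      using A(2)[unfolded lin_indep_family_def, rule_format, of "\<lambda>i. c (g (i, j))" i] that by simp
    from this[of "t mod m" "t mod n"] show ?thesis using gf[OF t] assms(2,3) by simp
  qed
  ultimately show ?thesis by (simp add: normal_elements_iff lin_indep_family_def)
qed

section \<open>Periodic coefficients and shifted families\<close>

text \<open>Moving the window by one loses \<open>f d\<close> and gains \<open>f (N + d)\<close>,
  which are equal; cancellation stands in for subtraction.\<close>

lemma sum_lessThan_periodic_shift:
  fixes f :: "nat \<Rightarrow> 'b :: cancel_comm_monoid_add"
  assumes "\<And>i. f (i + N) = f i"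
  shows "(\<Sum>i<N. f (i + d)) = (\<Sum>i<N. f i)"
proof (induction d)
  case (Suc d)
  have "f d + (\<Sum>i<N. f (i + Suc d)) = (\<Sum>i<N. f (i + d)) + f (N + d)"
    using sum.lessThan_Suc_shift[of "\<lambda>i. f (i + d)" N] by simp
  also have "f (N + d) = f d" using assms[of d] by (simp add: add.commute)
  finally have "f d + (\<Sum>i<N. f (i + Suc d)) = f d + (\<Sum>i<N. f (i + d))"
    by (simp add: add.commute)
  thus ?case using Suc.IH by simp
qed simp

lemma periodic_add_mult:
  fixes N :: nat
  assumes "\<And>i. f (i + N) = f i"
  shows "f (i + N * j) = f i"
proof (induction j)
  case (Suc j)
  have "f (i + N * Suc j) = f ((i + N * j) + N)" by (simp add: ac_simps)
  thus ?case using Suc.IH assms by simp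
qed simp

text \<open>Coefficients below \<open>N\<close> and their periodic extension carry the same data;
  the periodic form can be shifted without reducing indices.\<close>

lemma lin_indep_family_iff_periodic:
  fixes v :: "nat \<Rightarrow> 'a :: finite_field alg_closure"
  assumes "N > 0"
  shows "lin_indep_family N v \<longleftrightarrow>
    (\<forall>c :: nat \<Rightarrow> 'a. (\<forall>i. c (i + N) = c i) \<longrightarrow> (\<Sum>i<N. to_ac (c i) * v i) = 0 \<longrightarrow> (\<forall>i. c i = 0))"
proof safe
  fix c :: "nat \<Rightarrow> 'a" and i
  assume "lin_indep_family N v" and c: "\<forall>i. c (i + N) = c i" and "(\<Sum>i<N. to_ac (c i) * v i) = 0"
  hence "c (i mod N) = 0" using assms by (simp add: lin_indep_family_def)
  thus "c i = 0" using periodic_add_mult[of c N "i mod N" "i div N"] c by simp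
next
  assume *: "\<forall>c :: nat \<Rightarrow> 'a. (\<forall>i. c (i + N) = c i) \<longrightarrow> (\<Sum>i<N. to_ac (c i) * v i) = 0 \<longrightarrow> (\<forall>i. c i = 0)"
  show "lin_indep_family N v"
    unfolding lin_indep_family_def
  proof (intro allI impI)
    fix c :: "nat \<Rightarrow> 'a" and i
    assume "(\<Sum>i<N. to_ac (c i) * v i) = 0" and "i < N"
    with *[rule_format, of "\<lambda>i. c (i mod N)" i] show "c i = 0" by simp
  qed
qed

lemma lin_indep_family_shift:
  fixes v :: "nat \<Rightarrow> 'a :: finite_field alg_closure"
  assumes "N > 0" and per: "\<And>i. v (i + N) = v i" and "lin_indep_family N v"
  shows "lin_indep_family N (\<lambda>i. v (i + d))"
  unfolding lin_indep_family_iff_periodic[OF assms(1)]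
proof (intro allI impI)
  fix c :: "nat \<Rightarrow> 'a" and i
  assume c: "\<forall>i. c (i + N) = c i" and rel: "(\<Sum>i<N. to_ac (c i) * v (i + d)) = 0"
  \<comment> \<open>The shift by -d: \<open>N * d - d\<close> is congruent to it mod
    \<open>N\<close>, and no truncation occurs since \<open>N > 0\<close>.\<close>
  define c' where "c' i = c (i + (N * d - d))" for i
  have shift: "c' (i + d) = c i" for i
    using periodic_add_mult[of c N i d] c assms(1) by (simp add: c'_def)
  have per': "c' (i + N) = c' i" for i
    using c[rule_format, of "i + (N * d - d)"] by (simp add: c'_def ac_simps)
  have "(\<Sum>i<N. to_ac (c i) * v (i + d)) = (\<Sum>i<N. to_ac (c' (i + d)) * v (i + d))"
    by (simp add: shift)
  also have "\<dots> = (\<Sum>i<N. to_ac (c' i) * v i)"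
    by (rule sum_lessThan_periodic_shift) (simp add: per per')
  finally have "c' (i + d) = 0"
    using rel assms(3)[unfolded lin_indep_family_iff_periodic[OF assms(1)]] per' by simp
  thus "c i = 0" by (simp add: shift)
qed

text \<open>Reindexing the first summand gathers a relation into coefficients
  \<open>c (i + d) + c i\<close> on the shifted family \<open>v (i + d)\<close>, which is again
  independent.\<close>

lemma lin_indep_family_add_shift_iff:
  fixes v :: "nat \<Rightarrow> 'a :: finite_field alg_closure"
  assumes "N > 0" and per: "\<And>i. v (i + N) = v i" and indep: "lin_indep_family N v"
  shows "lin_indep_family N (\<lambda>i. v i + v (i + d)) \<longleftrightarrow>
    (\<forall>c :: nat \<Rightarrow> 'a. (\<forall>i. c (i + N) = c i) \<longrightarrow> (\<forall>i. c (i + d) = - c i) \<longrightarrow> (\<forall>i. c i = 0))"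
proof -
  have "(\<Sum>i<N. to_ac (c i) * (v i + v (i + d))) = 0 \<longleftrightarrow> (\<forall>i. c (i + d) = - c i)"
    if c: "\<forall>i. c (i + N) = c i" for c :: "nat \<Rightarrow> 'a"
  proof -
    have "(\<Sum>i<N. to_ac (c i) * v i) = (\<Sum>i<N. to_ac (c (i + d)) * v (i + d))"
      by (rule sum_lessThan_periodic_shift[symmetric]) (simp add: c per)
    hence eq: "(\<Sum>i<N. to_ac (c i) * (v i + v (i + d))) = (\<Sum>i<N. to_ac (c (i + d) + c i) * v (i + d))"
      by (simp add: algebra_simps sum.distrib)
    have "c (i + N + d) = c (i + d)" for i
      using c[rule_format, of "i + d"] by (simp add: ac_simps)
    hence "(\<forall>i. c (i + d) + c i = 0)" if "(\<Sum>i<N. to_ac (c (i + d) + c i) * v (i + d)) = 0"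
      using lin_indep_family_shift[OF assms(1) per indep, of d,
          unfolded lin_indep_family_iff_periodic[OF assms(1)], rule_format, of "\<lambda>i. c (i + d) + c i"]
        that c by simp
    moreover have "(\<Sum>i<N. to_ac (c (i + d) + c i) * v (i + d)) = 0" if "\<forall>i. c (i + d) + c i = 0"
      using that by (simp del: to_ac_add)
    ultimately show ?thesis unfolding eq add_eq_0_iff2 by blast
  qed
  thus ?thesis unfolding lin_indep_family_iff_periodic[OF assms(1)] by auto
qed

section \<open>Antiperiodic sequences and 2-adic valuations\<close>

text \<open>
  For the nontrivial antiperiodic sequence, the sign alternates on blocks of length \<open>2 ^ w\<close>,
  where \<open>w\<close> is the \<open>2\<close>-adic valuation of \<open>d\<close>.
\<close>
lemma antiperiodic_imp_zero_iff:
  fixes N d :: nat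
  assumes "N > 0"
  shows "(\<forall>c :: nat \<Rightarrow> 'a :: idom. (\<forall>i. c (i + N) = c i) \<longrightarrow> (\<forall>i. c (i + d) = - c i) \<longrightarrow> (\<forall>i. c i = 0)) \<longleftrightarrow>
    (1 :: 'a) + 1 \<noteq> 0 \<and> 2 ^ multiplicity 2 N dvd d" (is "?L \<longleftrightarrow> ?R")
proof
  assume L: ?L
  have two: "(1 :: 'a) + 1 \<noteq> 0"
  proof
    assume "(1 :: 'a) + 1 = 0"
    hence "(1 :: 'a) = - 1" by (simp add: eq_neg_iff_add_eq_0)
    with L[rule_format, of "\<lambda>_. 1" 0] show False by simp
  qed
  moreover have "2 ^ multiplicity 2 N dvd d"
  proof (rule ccontr)
    assume ndvd: "\<not> 2 ^ multiplicity 2 N dvd d"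
    hence "d \<noteq> 0" by (metis dvd_0_right)
    define w where "w = multiplicity 2 d"
    obtain s where s: "d = 2 ^ w * s" "odd s"
      using multiplicity_decompose'[of d 2] \<open>d \<noteq> 0\<close> by (auto simp: w_def)
    have "Suc w \<le> multiplicity 2 N"
      using ndvd multiplicity_dvd'[of "multiplicity 2 N" 2 d] by (force simp: w_def)
    hence "2 ^ Suc w dvd N" by (rule multiplicity_dvd')
    then obtain t where t: "N = 2 ^ w * (2 * t)" by (auto elim!: dvdE simp: ac_simps)
    \<comment> \<open>\<open>N\<close> spans \<open>2 * t\<close> blocks, an even number, and keeps
      the sign; \<open>d\<close> spans the odd number \<open>s\<close> of blocks and reverses
      it.\<close>
    let ?c = "\<lambda>i. (- 1 :: 'a) ^ (i div 2 ^ w)"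
    have "?c (i + N) = ?c i" for i by (simp add: t power_add)
    moreover have "?c (i + d) = - ?c i" for i using s(2) by (simp add: s(1) power_add)
    ultimately show False using L[rule_format, of ?c 0] by simp
  qed
  ultimately show ?R ..
next
  assume R: ?R
  show ?L
  proof (intro allI impI)
    fix c :: "nat \<Rightarrow> 'a" and i
    assume per: "\<forall>i. c (i + N) = c i" and anti: "\<forall>i. c (i + d) = - c i"
    obtain r where r: "N = 2 ^ multiplicity 2 N * r" "odd r"
      using multiplicity_decompose'[of N 2] assms by auto
    obtain s where s: "d = 2 ^ multiplicity 2 N * s" using R by (auto elim: dvdE)
    \<comment> \<open>Since \<open>d * r = N * s\<close>, taking \<open>r\<close> steps of length
      \<open>d\<close> is a whole number of periods, yet as \<open>r\<close> is odd it flips the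
      sign; thus \<open>2 * c i = 0\<close>.\<close>
    have "c (i + d * j) = (- 1) ^ j * c i" for j
    proof (induction j)
      case (Suc j)
      have "c (i + d * Suc j) = c ((i + d * j) + d)" by (simp add: ac_simps)
      thus ?case using Suc.IH anti by simp
    qed simp
    hence "- c i = c (i + d * r)" using r(2) by simp
    also have "d * r = N * s" by (subst s, subst (2) r(1)) (simp add: ac_simps)
    also have "c (i + N * s) = c i" using per by (intro periodic_add_mult) simp
    finally have "(1 + 1) * c i = 0" by (simp add: distrib_right neg_eq_iff_add_eq_0)
    thus "c i = 0" using R by simp
  qed
qed

text \<open>At \<open>k = 0\<close> the two sides agree: the valuation is infinite and every number
  divides 0.\<close>

lemma nu2_le_iff:
  assumes "m > 0"
  shows "nu2 (int m) \<le> nu2 (int k) \<longleftrightarrow> 2 ^ multiplicity 2 m dvd k"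
proof -
  have pow: "2 ^ e dvd int j \<longleftrightarrow> 2 ^ e dvd j" for e j :: nat
    using int_dvd_int_iff[of "2 ^ e" j] by simp
  have "multiplicity 2 (int j) = multiplicity 2 j" for j
    by (simp add: multiplicity_def pow)
  thus ?thesis using assms
    by (cases "k = 0") (simp_all add: nu2_def power_dvd_iff_le_multiplicity)
qed

text \<open>Coprimality leaves at most one of \<open>m\<close>, \<open>n\<close> even, so the 2-part
  of \<open>m * n\<close> is that of a single factor, modulo which \<open>d\<close> is
  \<open>k\<close> or -l; the sign does not affect divisibility. If both are odd, the 2-part is
  1.\<close>

lemma two_adic_criterion:
  fixes m n d k l :: nat
  assumes "m > 0" and "n > 0" and "coprime m n" and d: "[d = k] (mod m)" "[d + l = 0] (mod n)"
  shows "2 ^ multiplicity 2 (m * n) dvd d \<longleftrightarrow>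
    odd m \<and> odd n \<or> even m \<and> nu2 (int m) \<le> nu2 (int k) \<or> even n \<and> nu2 (int n) \<le> nu2 (int l)"
proof -
  have mult: "multiplicity 2 (m * n) = multiplicity 2 m + multiplicity 2 n"
    using assms(1,2) by (simp add: prime_elem_multiplicity_mult_distrib)
  have k: "2 ^ multiplicity 2 m dvd d \<longleftrightarrow> 2 ^ multiplicity 2 m dvd k"
    using cong_dvd_modulus_nat[OF d(1) multiplicity_dvd] by (rule cong_dvd_iff)
  have "2 ^ multiplicity 2 n dvd d + l"
    using d(2) by (meson cong_0_iff dvd_trans multiplicity_dvd)
  hence l: "2 ^ multiplicity 2 n dvd d \<longleftrightarrow> 2 ^ multiplicity 2 n dvd l"
    by (metis dvd_add_left_iff dvd_add_right_iff)
  have "odd m \<or> odd n" using assms(3) by (meson coprime_common_divisor_nat coprime_def odd_one)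
  thus ?thesis
    using k l assms(1,2) by (auto simp: mult nu2_le_iff not_dvd_imp_multiplicity_0)
qed

section \<open>The given element as a sum of two conjugates of alpha * beta\<close>

theorem theorem4p6:
  fixes \<alpha> \<beta> :: "'a :: finite_field alg_closure" and q m n k l :: nat
  assumes "q = CARD('a)"
    and "m \<ge> 1" and "n \<ge> 1" and "coprime m n"
    and "\<alpha> \<in> normal_elements m" and "\<beta> \<in> normal_elements n"
  shows "\<alpha> ^ (q ^ k) * \<beta> + \<alpha> * \<beta> ^ (q ^ l) \<in> Fext (m * n) \<and>
    (\<alpha> ^ (q ^ k) * \<beta> + \<alpha> * \<beta> ^ (q ^ l) \<in> normal_elements (m * n) \<longleftrightarrow>
       odd q \<and>
       (odd m \<and> odd n
        \<or> even m \<and> nu2 (int m) \<le> nu2 (int k)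
        \<or> even n \<and> nu2 (int n) \<le> nu2 (int l)))"
proof -
  have pos: "m > 0" "n > 0" "m * n > 0" using assms(2,3) by auto
  have \<alpha>: "\<alpha> \<in> Fext m" and \<beta>: "\<beta> \<in> Fext n"
    using assms(5,6) by (simp_all add: normal_elements_iff)
  \<comment> \<open>phi^b must fix alpha and act on beta as phi^l, giving the second
    summand.\<close>
  obtain b where b: "[b = 0] (mod m)" "[b = l] (mod n)"
    using binary_chinese_remainder_nat[OF assms(4)] by blast
  \<comment> \<open>phi^(b+d) must act on alpha as phi^k and fix beta, so \<open>d\<close> is k mod
    \<open>m\<close> and -l mod \<open>n\<close>; \<open>n * l - l\<close> represents -l without
    truncation.\<close>
  obtain d where d: "[d = k] (mod m)" "[d = n * l - l] (mod n)"
    using binary_chinese_remainder_nat[OF assms(4)] by blast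
  have dl: "[d + l = 0] (mod n)"
    using cong_add[OF d(2) cong_refl[of l]] pos(2) by (simp add: cong_def)
  have bd: "[b + d = k] (mod m)" "[b + d = 0] (mod n)"
    using cong_add[OF b(1) d(1)] cong_trans[OF cong_add[OF b(2) cong_refl[of d]]] dl
    by (simp_all add: add.commute)
  define \<theta> where "\<theta> i = frob i (\<alpha> * \<beta>)" for i
  have norm: "\<alpha> * \<beta> \<in> normal_elements (m * n)"
    using normal_elements_mult[OF assms(4) pos(1,2) assms(5,6)] .
  hence \<theta>: "lin_indep_family (m * n) \<theta>" and \<alpha>\<beta>: "\<alpha> * \<beta> \<in> Fext (m * n)"
    unfolding \<theta>_def by (simp_all add: normal_elements_iff)
  have per: "\<theta> (i + m * n) = \<theta> i" for i
    unfolding \<theta>_def by (rule frob_Fext_cong[OF \<alpha>\<beta>]) (simp add: cong_def)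
  let ?\<gamma> = "\<alpha> ^ (q ^ k) * \<beta> + \<alpha> * \<beta> ^ (q ^ l)"
  have "frob b (\<alpha> * \<beta>) = \<alpha> * frob l \<beta>"
    using frob_Fext_cong[OF \<alpha> b(1)] frob_Fext_cong[OF \<beta> b(2)] by simp
  moreover have "frob (b + d) (\<alpha> * \<beta>) = frob k \<alpha> * \<beta>"
    using frob_Fext_cong[OF \<alpha> bd(1)] frob_Fext_cong[OF \<beta> bd(2)] by simp
  ultimately have \<gamma>: "?\<gamma> = \<theta> b + \<theta> (b + d)"
    by (simp add: \<theta>_def assms(1) frob_def add.commute)
  \<comment> \<open>The conjugates start at offset \<open>b\<close>, so the criterion is applied to
    the family \<theta> shifted by \<open>b\<close>.\<close>
  have "frob i ?\<gamma> = \<theta> (i + b) + \<theta> (i + b + d)" for i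
    unfolding \<gamma> \<theta>_def frob_add frob_frob add.assoc ..
  moreover have "lin_indep_family (m * n) (\<lambda>i. \<theta> (i + b) + \<theta> (i + b + d)) \<longleftrightarrow>
      odd q \<and> 2 ^ multiplicity 2 (m * n) dvd d"
    using lin_indep_family_add_shift_iff[OF pos(3) _ lin_indep_family_shift[OF pos(3) per \<theta>, of b], of d]
      per[of "_ + b"] antiperiodic_imp_zero_iff[OF pos(3), of d, where ?'a = 'a]
    by (simp add: add.assoc add.commute add.left_commute even_CARD_finite_field_iff assms(1))
  moreover have "?\<gamma> \<in> Fext (m * n)"
    using frob_Fext[OF \<alpha>\<beta>] unfolding \<gamma> \<theta>_def by (simp add: Fext_iff)
  ultimately show ?thesis
    unfolding normal_elements_iff using two_adic_criterion[OF pos(1,2) assms(4) d(1) dl] by simp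
qed

end
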